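(* For each $n\ge 1$ let $X_{1,n},\dots,X_{n,n}$ be independent Bernoulli random variables with $P(X_{i,n}=1)=b(i;n)$, let $V_n=X_{1,n}+\cdots+X_{n,n}$, $\lambda_n=\sum_{i=1}^n b(i;n)$, $m_n=\max_{1\le i\le n} b(i;n)$ and $\beta_n=\sum_{i=1}^n \frac{b(i;n)}{1-b(i;n)}$. Suppose there is a constant $\beta$ such that $m_n<\beta<1$ for all $n$. If $\lim_{n\to+\infty}\lambda_n=+\infty$, then for any function $\phi(n)$ such that $\frac{\phi(n)}{\lambda_n}\to 0$ as $n\to+\infty$, $$\sup_{\{k:\,k^2\le\phi(n)\}}\left|\frac{P(V_n=k)}{P(V_n=0)\,\beta_n^k/k!}-1\right|\longrightarrow 0\qquad (n\to+\infty).$$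
   Context: The $X_{i,n}$ take values in $\{0,1\}$ and are not assumed identically distributed; they form a triangular array, so $b(i;n)\in[0,1]$ may depend on $n$. The function $\phi$ is a real-valued function of the positive integer $n$. In the supremum, $k$ ranges over non-negative integers (a supremum over the empty set is taken to be $0$). *)

theory Defs
  imports "HOL-Probability.Probability"
begin

text \<open>
  Throughout, the array entry with row \<open>n\<close> and position \<open>i \<in> {1..n}\<close> is indexed as
  \<open>X i n\<close> and \<open>b i n\<close>; entries outside \<open>1 \<le> i \<le> n\<close> are irrelevant.
\<close>

definition row_sum :: "(nat \<Rightarrow> nat \<Rightarrow> 'a \<Rightarrow> nat) \<Rightarrow> nat \<Rightarrow> 'a \<Rightarrow> nat" where
  "row_sum X n \<omega> = (\<Sum>i=1..n. X i n \<omega>)"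

definition row_mean :: "(nat \<Rightarrow> nat \<Rightarrow> real) \<Rightarrow> nat \<Rightarrow> real" where
  "row_mean b n = (\<Sum>i=1..n. b i n)"

definition row_max :: "(nat \<Rightarrow> nat \<Rightarrow> real) \<Rightarrow> nat \<Rightarrow> real" where
  "row_max b n = Max ((\<lambda>i. b i n) ` {1..n})"

definition row_odds :: "(nat \<Rightarrow> nat \<Rightarrow> real) \<Rightarrow> nat \<Rightarrow> real" where
  "row_odds b n = (\<Sum>i=1..n. b i n / (1 - b i n))"

text \<open>
  Supremum of a set of nonnegative reals with value \<open>0\<close> on the empty set, where the
  library's real \<open>Sup\<close> is unspecified. It is only applied to finite sets below, since
  \<open>{k::nat. real k ^ 2 \<le> c}\<close> is finite for every real \<open>c\<close>.
\<close>

definition Sup0 :: "real set \<Rightarrow> real" where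
  "Sup0 A = (if A = {} then 0 else Sup A)"

end

theory Submission
  imports Defs
begin

text \<open>
  Splitting by the set of variables that equal \<open>1\<close> shows that \<open>P(V = k) / P(V = 0)\<close> is the
  elementary symmetric polynomial \<open>e\<^sub>k\<close> evaluated at the odds \<open>r\<^sub>i = b\<^sub>i / (1 - b\<^sub>i)\<close>. The claim is
  therefore that \<open>k! e\<^sub>k\<close> approximates \<open>B\<^sup>k\<close> with uniformly small relative error, where \<open>B = e\<^sub>1\<close> is the sum of the odds.

  Expanding \<open>B\<^sup>k\<close> gives all \<open>k\<close>-tuples of indices, while \<open>k! e\<^sub>k\<close> keeps the tuples without
  repetition; repetitions are rare when no single \<open>r\<^sub>i\<close> carries a large share of \<open>B\<close>
  and \<open>k\<close> is small. The
  estimate is obtained one factor at a time. Marking an element of a \<open>(k+1)\<close>-subset gives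
  \<open>(k + 1) e\<^sub>k\<^sub>+\<^sub>1(A) = \<Sum>\<^sub>i r\<^sub>i e\<^sub>k(A - {i})\<close>, and deleting an index with \<open>r\<^sub>i \<le> R\<close> costs little
  because \<open>e\<^sub>k(A) - e\<^sub>k(A - {i}) = r\<^sub>i e\<^sub>k\<^sub>-\<^sub>1(A - {i})\<close>. Applying the marking identity again to the
  loss yields \<open>(B - R k) e\<^sub>k \<le> (k + 1) e\<^sub>k\<^sub>+\<^sub>1 \<le> B e\<^sub>k\<close> (\<open>esym_Suc_le\<close>, \<open>esym_Suc_ge\<close>), and
  multiplying these up, \<open>\<bar>k! e\<^sub>k / B\<^sup>k - 1\<bar> \<le> R k\<^sup>2 / B\<close> (\<open>esym_ratio_bound\<close>).

  Since the success probabilities stay below \<open>\<beta> < 1\<close>, one may take \<open>R = 1 / (1 - \<beta>)\<close> for every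
  row. As \<open>B\<close> is at least the mean \<open>\<lambda>\<close>, the range \<open>k\<^sup>2 \<le> \<phi>\<close> gives an error of at most
  \<open>R \<bar>\<phi> / \<lambda>\<bar>\<close>, which tends to \<open>0\<close>.
\<close>

section \<open>Elementary symmetric polynomials\<close>

definition esym :: "('i \<Rightarrow> 'b::comm_semiring_1) \<Rightarrow> 'i set \<Rightarrow> nat \<Rightarrow> 'b" where
  "esym r A k = (\<Sum>S | S \<subseteq> A \<and> card S = k. \<Prod>i\<in>S. r i)"

lemma esym_0:
  assumes "finite A"
  shows "esym r A 0 = 1"
proof -
  have "{S. S \<subseteq> A \<and> card S = 0} = {{}}"
    using assms by (auto dest: finite_subset)
  then show ?thesis by (simp add: esym_def)
qed

lemma esym_nonneg:
  fixes r :: "'i \<Rightarrow> real"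
  assumes "\<And>i. i \<in> A \<Longrightarrow> 0 \<le> r i"
  shows "0 \<le> esym r A k"
  unfolding esym_def by (intro sum_nonneg prod_nonneg) (use assms in auto)

text \<open>The \<open>(k+1)\<close>-subsets of \<open>A\<close> that contain \<open>i\<close> are the \<open>k\<close>-subsets of \<open>A - {i}\<close> with \<open>i\<close> adjoined.\<close>

lemma sum_subsets_containing:
  assumes "finite A" "i \<in> A"
  shows "(\<Sum>T | (T \<subseteq> A \<and> card T = Suc k) \<and> i \<in> T. \<Prod>j\<in>T. r j) = r i * esym r (A - {i}) k"
proof -
  have "(\<Sum>T | (T \<subseteq> A \<and> card T = Suc k) \<and> i \<in> T. \<Prod>j\<in>T. r j)
      = (\<Sum>S | S \<subseteq> A - {i} \<and> card S = k. r i * (\<Prod>j\<in>S. r j))"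
  proof (rule sum.reindex_bij_witness[where j = "\<lambda>T. T - {i}" and i = "insert i"])
    fix T assume "T \<in> {T. (T \<subseteq> A \<and> card T = Suc k) \<and> i \<in> T}"
    then have T: "T \<subseteq> A" "card T = Suc k" "i \<in> T" "finite T"
      using assms(1) by (auto dest: finite_subset)
    show "insert i (T - {i}) = T" using T by auto
    show "T - {i} \<in> {S. S \<subseteq> A - {i} \<and> card S = k}" using T by auto
    show "r i * (\<Prod>j\<in>T - {i}. r j) = (\<Prod>j\<in>T. r j)"
      using prod.remove[OF T(4,3), of r] by simp
  next
    fix S assume "S \<in> {S. S \<subseteq> A - {i} \<and> card S = k}"
    then have S: "S \<subseteq> A - {i}" "card S = k" "finite S"
      using assms(1) by (auto dest: finite_subset)
    show "insert i S - {i} = S" using S by auto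
    have "i \<notin> S" using S by auto
    then show "insert i S \<in> {T. (T \<subseteq> A \<and> card T = Suc k) \<and> i \<in> T}"
      using S assms(2) by auto
  qed
  then show ?thesis by (simp add: esym_def sum_distrib_left)
qed

lemma esym_Suc_remove:
  assumes "finite A" "i \<in> A"
  shows "esym r A (Suc k) = esym r (A - {i}) (Suc k) + r i * esym r (A - {i}) k"
proof -
  let ?F = "{T. T \<subseteq> A \<and> card T = Suc k}"
  have fin: "finite ?F" using assms(1) by (auto intro: finite_subset[of _ "Pow A"])
  have "esym r A (Suc k) = (\<Sum>T\<in>?F - {T\<in>?F. i \<in> T}. \<Prod>j\<in>T. r j) + (\<Sum>T\<in>{T\<in>?F. i \<in> T}. \<Prod>j\<in>T. r j)"
    unfolding esym_def by (rule sum.subset_diff) (use fin in auto)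
  moreover have "?F - {T\<in>?F. i \<in> T} = {T. T \<subseteq> A - {i} \<and> card T = Suc k}" by auto
  moreover have "(\<Sum>T\<in>{T\<in>?F. i \<in> T}. \<Prod>j\<in>T. r j) = r i * esym r (A - {i}) k"
    using sum_subsets_containing[OF assms, where k = k and r = r] by simp
  ultimately show ?thesis by (simp add: esym_def)
qed

text \<open>Double counting of the pairs of a \<open>(k+1)\<close>-subset and a marked element in it.\<close>

lemma esym_marking:
  assumes "finite A"
  shows "of_nat (Suc k) * esym r A (Suc k) = (\<Sum>i\<in>A. r i * esym r (A - {i}) k)"
proof -
  let ?F = "{T. T \<subseteq> A \<and> card T = Suc k}"
  have fin: "finite ?F" using assms by (auto intro: finite_subset[of _ "Pow A"])
  have "of_nat (Suc k) * esym r A (Suc k) = (\<Sum>T\<in>?F. \<Sum>i | i \<in> A \<and> i \<in> T. \<Prod>j\<in>T. r j)"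
    unfolding esym_def sum_distrib_left
  proof (rule sum.cong)
    fix T assume T: "T \<in> ?F"
    then have "{i. i \<in> A \<and> i \<in> T} = T" by auto
    with T show "of_nat (Suc k) * (\<Prod>j\<in>T. r j) = (\<Sum>i | i \<in> A \<and> i \<in> T. \<Prod>j\<in>T. r j)"
      by simp
  qed simp
  also have "\<dots> = (\<Sum>i\<in>A. \<Sum>T | T \<in> ?F \<and> i \<in> T. \<Prod>j\<in>T. r j)"
    using sum.swap_restrict[OF fin assms, of "\<lambda>T i. \<Prod>j\<in>T. r j" "\<lambda>T i. i \<in> T"] by simp
  also have "\<dots> = (\<Sum>i\<in>A. r i * esym r (A - {i}) k)"
    using sum_subsets_containing[OF assms, where k = k and r = r] by (intro sum.cong) auto
  finally show ?thesis .
qed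

section \<open>Comparison with powers of the sum\<close>

lemma esym_remove_le:
  fixes r :: "'i \<Rightarrow> real"
  assumes "finite A" "i \<in> A" "\<And>i. i \<in> A \<Longrightarrow> 0 \<le> r i"
  shows "esym r (A - {i}) k \<le> esym r A k"
proof (cases k)
  case 0
  then show ?thesis using assms(1) by (simp add: esym_0)
next
  case (Suc l)
  have "0 \<le> r i * esym r (A - {i}) l"
    using assms by (intro mult_nonneg_nonneg esym_nonneg) auto
  then show ?thesis using esym_Suc_remove[OF assms(1,2), where k = l and r = r] Suc by simp
qed

lemma esym_Suc_le:
  fixes r :: "'i \<Rightarrow> real"
  assumes "finite A" "\<And>i. i \<in> A \<Longrightarrow> 0 \<le> r i"
  shows "real (Suc k) * esym r A (Suc k) \<le> sum r A * esym r A k"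
  unfolding esym_marking[OF assms(1)] sum_distrib_right
  by (intro sum_mono mult_left_mono esym_remove_le) (use assms in auto)

text \<open>
  Deleting \<open>i\<close> from \<open>A\<close> lowers \<open>e\<^sub>k\<close> by \<open>r\<^sub>i e\<^sub>k\<^sub>-\<^sub>1(A - {i}) \<le> R e\<^sub>k\<^sub>-\<^sub>1(A - {i})\<close>. Weighted by \<open>r\<^sub>i\<close> and
  summed over \<open>i\<close>, these losses reassemble to at most \<open>R k e\<^sub>k\<close> by the marking identity.
\<close>

lemma esym_Suc_ge:
  fixes r :: "'i \<Rightarrow> real"
  assumes "finite A" "\<And>i. i \<in> A \<Longrightarrow> 0 \<le> r i" "\<And>i. i \<in> A \<Longrightarrow> r i \<le> R"
  shows "(sum r A - R * real k) * esym r A k \<le> real (Suc k) * esym r A (Suc k)"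
proof (cases k)
  case 0
  then show ?thesis
    using esym_marking[OF assms(1), where k = 0 and r = r] assms(1) by (simp add: esym_0)
next
  case (Suc l)
  have "sum r A * esym r A k - real (Suc k) * esym r A (Suc k)
      = (\<Sum>i\<in>A. r i * (r i * esym r (A - {i}) l))"
    unfolding esym_marking[OF assms(1)] sum_distrib_right sum_subtractf[symmetric]
    by (intro sum.cong) (auto simp: Suc esym_Suc_remove[OF assms(1)] algebra_simps)
  also have "\<dots> \<le> (\<Sum>i\<in>A. R * (r i * esym r (A - {i}) l))"
    by (intro sum_mono mult_right_mono mult_nonneg_nonneg esym_nonneg) (use assms in auto)
  also have "\<dots> = R * real k * esym r A k"
    by (simp only: sum_distrib_left[symmetric] esym_marking[OF assms(1), symmetric] Suc mult.assoc)
  finally show ?thesis by (simp add: algebra_simps)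
qed

text \<open>
  The normalised values \<open>q\<^sub>k = k! e\<^sub>k / B\<^sup>k\<close> start at \<open>1\<close>, never increase, and drop by at most
  \<open>R k / B\<close> from \<open>k\<close> to \<open>k + 1\<close>; the drops before \<open>k\<close> add up to at most \<open>R k\<^sup>2 / B\<close>.
\<close>

lemma esym_ratio_bound:
  fixes r :: "'i \<Rightarrow> real"
  assumes "finite A" "\<And>i. i \<in> A \<Longrightarrow> 0 \<le> r i" "\<And>i. i \<in> A \<Longrightarrow> r i \<le> R"
    and R: "0 \<le> R" and B: "0 < sum r A"
  shows "\<bar>esym r A k / (sum r A ^ k / fact k) - 1\<bar> \<le> R * real k ^ 2 / sum r A"
proof -
  define B where "B = sum r A"
  define q where "q k = esym r A k / (B ^ k / fact k)" for k
  have Bpos: "0 < B" using B by (simp add: B_def)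
  have step: "q (Suc k) = real (Suc k) * esym r A (Suc k) / B * (fact k / B ^ k)" for k
    by (simp add: q_def)
  have q_pow: "q k = esym r A k * (fact k / B ^ k)" for k
    by (simp add: q_def)
  have decr: "q (Suc k) \<le> q k" for k
  proof -
    have "real (Suc k) * esym r A (Suc k) / B \<le> esym r A k"
      using esym_Suc_le[where A = A and r = r and k = k, OF assms(1,2)] Bpos by (simp add: B_def divide_le_eq mult.commute)
    then show ?thesis
      unfolding step[of k] q_pow[of k] using Bpos by (intro mult_right_mono) auto
  qed
  have q0: "q 0 = 1" using assms(1) by (simp add: q_def esym_0)
  have le1: "q k \<le> 1" for k
    by (induction k) (use q0 decr order_trans in auto)
  have drop: "q k - R * real k / B \<le> q (Suc k)" for k
  proof -
    have "(B - R * real k) * esym r A k / B \<le> real (Suc k) * esym r A (Suc k) / B"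
      using esym_Suc_ge[where A = A and r = r and R = R and k = k, OF assms(1-3)] Bpos
      unfolding B_def by (intro divide_right_mono) auto
    moreover have "(B - R * real k) * esym r A k / B = esym r A k - R * real k / B * esym r A k"
      using Bpos by (simp add: field_simps)
    ultimately have "(esym r A k - R * real k / B * esym r A k) * (fact k / B ^ k) \<le> q (Suc k)"
      unfolding step using Bpos by (intro mult_right_mono) auto
    then have "q k - R * real k / B * q k \<le> q (Suc k)"
      unfolding q_pow[of k] by (simp only: left_diff_distrib mult.assoc)
    moreover have "R * real k / B * q k \<le> R * real k / B * 1"
      using le1 R Bpos by (intro mult_left_mono) auto
    ultimately show ?thesis by simp
  qed
  have "1 - R * real k ^ 2 / B \<le> q k"
  proof (induction k)
    case 0
    then show ?case by (simp add: q0)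
  next
    case (Suc k)
    have "R * real k ^ 2 / B + R * real k / B = R * (real k ^ 2 + real k) / B"
      by (simp add: distrib_left add_divide_distrib)
    also have "\<dots> \<le> R * real (Suc k) ^ 2 / B"
      using R Bpos by (intro divide_right_mono mult_left_mono) (auto simp: power2_eq_square algebra_simps)
    finally show ?case using Suc drop[of k] by linarith
  qed
  moreover have "0 \<le> R * real k ^ 2 / B" using R Bpos by simp
  ultimately have "\<bar>q k - 1\<bar> \<le> R * real k ^ 2 / B"
    using le1[of k] by linarith
  then show ?thesis by (simp add: q_def B_def)
qed

section \<open>Sums of independent Bernoulli variables\<close>

text \<open>
  The event \<open>V = k\<close> splits according to the set \<open>S\<close> of indices where the variable is \<open>1\<close>.
  By independence each piece has probability \<open>(\<Prod>i\<in>S. p i) * (\<Prod>i\<in>A - S. 1 - p i)\<close>, and factoring out \<open>\<Prod>i\<in>A. 1 - p i\<close> leaves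
  the product of the odds over \<open>S\<close>.
\<close>

lemma (in prob_space) prob_sum_Bernoulli:
  fixes Y :: "'i \<Rightarrow> 'a \<Rightarrow> nat" and p :: "'i \<Rightarrow> real"
  assumes A: "finite A" "A \<noteq> {}"
    and ind: "indep_vars (\<lambda>_. count_space UNIV) Y A"
    and range: "\<And>i \<omega>. i \<in> A \<Longrightarrow> \<omega> \<in> space M \<Longrightarrow> Y i \<omega> \<in> {0, 1}"
    and p: "\<And>i. i \<in> A \<Longrightarrow> prob {\<omega> \<in> space M. Y i \<omega> = 1} = p i"
    and p_less: "\<And>i. i \<in> A \<Longrightarrow> p i < 1"
  shows "prob {\<omega> \<in> space M. (\<Sum>i\<in>A. Y i \<omega>) = k}
    = (\<Prod>i\<in>A. 1 - p i) * esym (\<lambda>i. p i / (1 - p i)) A k"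
proof -
  have meas: "random_variable (count_space UNIV) (Y i)" if "i \<in> A" for i
    using ind that by (auto simp: indep_vars_def2)
  have ev1: "Y i -` {1} \<inter> space M = {\<omega> \<in> space M. Y i \<omega> = 1}" for i by auto
  have p1: "prob (Y i -` {1} \<inter> space M) = p i" if "i \<in> A" for i
    unfolding ev1 by (rule p[OF that])
  have p0: "prob (Y i -` {0} \<inter> space M) = 1 - p i" if i: "i \<in> A" for i
  proof -
    have "Y i -` {0} \<inter> space M = space M - Y i -` {1} \<inter> space M"
      using range[OF i] by fastforce
    then show ?thesis
      using prob_compl[OF measurable_sets[OF meas[OF i], of "{1}"]] p1[OF i] by simp
  qed
  define v where "v S i = (if i \<in> S then 1 else 0 :: nat)" for S :: "'i set" and i
  define E where "E S = (\<Inter>i\<in>A. Y i -` {v S i} \<inter> space M)" for S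
  have E_iff: "\<omega> \<in> E S \<longleftrightarrow> \<omega> \<in> space M \<and> (\<forall>i\<in>A. Y i \<omega> = v S i)" for \<omega> S
    using A(2) by (auto simp: E_def)
  let ?F = "{S. S \<subseteq> A \<and> card S = k}"
  have fin: "finite ?F" using A(1) by (auto intro: finite_subset[of _ "Pow A"])
  have E_sets: "E S \<in> events" for S
    unfolding E_def
    by (intro sets.finite_INT A) (auto intro: measurable_sets[OF meas])
  have prob_E: "prob (E S) = (\<Prod>i\<in>A. 1 - p i) * (\<Prod>i\<in>S. p i / (1 - p i))" if S: "S \<subseteq> A" for S
  proof -
    have "prob (E S) = (\<Prod>i\<in>A. prob (Y i -` {v S i} \<inter> space M))"
      unfolding E_def by (rule indep_varsD[OF ind]) (use A in auto)
    also have "\<dots> = (\<Prod>i\<in>A. (1 - p i) * (if i \<in> S then p i / (1 - p i) else 1))"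
    proof (rule prod.cong)
      fix i assume "i \<in> A"
      then show "prob (Y i -` {v S i} \<inter> space M) = (1 - p i) * (if i \<in> S then p i / (1 - p i) else 1)"
        using p0 p1 p_less[of i] by (simp add: v_def)
    qed simp
    also have "\<dots> = (\<Prod>i\<in>A. 1 - p i) * (\<Prod>i\<in>S. p i / (1 - p i))"
      using S by (simp add: prod.distrib prod.inter_restrict[OF A(1), symmetric] Int_absorb1)
    finally show ?thesis .
  qed
  have "{\<omega> \<in> space M. (\<Sum>i\<in>A. Y i \<omega>) = k} = (\<Union>S\<in>?F. E S)"
  proof (intro set_eqI iffI)
    fix \<omega> assume "\<omega> \<in> {\<omega> \<in> space M. (\<Sum>i\<in>A. Y i \<omega>) = k}"
    then have \<omega>: "\<omega> \<in> space M" "(\<Sum>i\<in>A. Y i \<omega>) = k" by auto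
    define S where "S = {i \<in> A. Y i \<omega> = 1}"
    have Y: "Y i \<omega> = v S i" if "i \<in> A" for i
      using range[OF that \<omega>(1)] that by (auto simp: v_def S_def)
    have "k = (\<Sum>i\<in>A. v S i)" using \<omega>(2) Y by simp
    also have "\<dots> = card S"
      using A(1) by (simp add: v_def S_def sum.If_cases Int_def)
    finally show "\<omega> \<in> (\<Union>S\<in>?F. E S)"
      using Y \<omega>(1) by (auto simp: E_iff S_def intro!: exI[of _ S])
  next
    fix \<omega> assume "\<omega> \<in> (\<Union>S\<in>?F. E S)"
    then obtain S where S: "S \<subseteq> A" "card S = k" "\<omega> \<in> E S" by auto
    have "(\<Sum>i\<in>A. Y i \<omega>) = (\<Sum>i\<in>A. v S i)" using S(3) by (auto simp: E_iff)
    also have "\<dots> = card S"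
      using A(1) S(1) by (simp add: v_def sum.If_cases Int_absorb1)
    finally show "\<omega> \<in> {\<omega> \<in> space M. (\<Sum>i\<in>A. Y i \<omega>) = k}"
      using S by (auto simp: E_iff)
  qed
  moreover have "disjoint_family_on E ?F"
    unfolding disjoint_family_on_def
  proof (intro ballI impI)
    fix S T assume ST: "S \<in> ?F" "T \<in> ?F" "S \<noteq> T"
    then obtain i where "i \<in> A" "i \<in> S \<longleftrightarrow> i \<notin> T" by blast
    then have "i \<in> A" "v S i \<noteq> v T i" by (auto simp: v_def)
    then show "E S \<inter> E T = {}" by (fastforce simp: E_iff)
  qed
  ultimately have "prob {\<omega> \<in> space M. (\<Sum>i\<in>A. Y i \<omega>) = k} = (\<Sum>S\<in>?F. prob (E S))"
    using finite_measure_finite_Union[OF fin, of E] E_sets by auto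
  also have "\<dots> = (\<Sum>S\<in>?F. (\<Prod>i\<in>A. 1 - p i) * (\<Prod>i\<in>S. p i / (1 - p i)))"
    by (intro sum.cong) (auto simp: prob_E)
  finally show ?thesis by (simp add: esym_def sum_distrib_left)
qed

lemma Sup0_image_bounds:
  assumes "\<And>x. x \<in> K \<Longrightarrow> 0 \<le> f x" "\<And>x. x \<in> K \<Longrightarrow> f x \<le> c" "0 \<le> c"
  shows "0 \<le> Sup0 (f ` K)" "Sup0 (f ` K) \<le> c"
proof -
  show "Sup0 (f ` K) \<le> c"
    using assms by (auto simp: Sup0_def intro!: cSUP_least)
  show "0 \<le> Sup0 (f ` K)"
  proof (cases "K = {}")
    case False
    then obtain x where x: "x \<in> K" by auto
    have "f x \<le> Sup (f ` K)"
      by (rule cSUP_upper[OF x]) (use assms(2) in \<open>auto simp: bdd_above_def\<close>)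
    then show ?thesis using assms(1)[OF x] False by (simp add: Sup0_def)
  qed (simp add: Sup0_def)
qed

theorem theorem2:
  fixes M :: "nat \<Rightarrow> 'a measure"
    and X :: "nat \<Rightarrow> nat \<Rightarrow> 'a \<Rightarrow> nat"
    and b :: "nat \<Rightarrow> nat \<Rightarrow> real"
    and \<beta> :: real
    and \<phi> :: "nat \<Rightarrow> real"
  assumes prob: "\<And>n. n \<ge> 1 \<Longrightarrow> prob_space (M n)"
    and indep: "\<And>n. n \<ge> 1 \<Longrightarrow>
      prob_space.indep_vars (M n) (\<lambda>_. count_space UNIV) (\<lambda>i. X i n) {1..n}"
    and range01: "\<And>n i \<omega>. n \<ge> 1 \<Longrightarrow> i \<in> {1..n} \<Longrightarrow> \<omega> \<in> space (M n) \<Longrightarrow> X i n \<omega> \<in> {0, 1}"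
    and success: "\<And>n i. n \<ge> 1 \<Longrightarrow> i \<in> {1..n} \<Longrightarrow>
      measure (M n) {\<omega> \<in> space (M n). X i n \<omega> = 1} = b i n"
    and max_less: "\<And>n. n \<ge> 1 \<Longrightarrow> row_max b n < \<beta>"
    and beta_less: "\<beta> < 1"
    and mean_infinite: "filterlim (row_mean b) at_top sequentially"
    and phi: "(\<lambda>n. \<phi> n / row_mean b n) \<longlonglongrightarrow> 0"
  shows "(\<lambda>n. Sup0 ((\<lambda>k::nat.
            \<bar>measure (M n) {\<omega> \<in> space (M n). row_sum X n \<omega> = k} /
              (measure (M n) {\<omega> \<in> space (M n). row_sum X n \<omega> = 0} * (row_odds b n ^ k / fact k)) - 1\<bar>)
          ` {k. real k ^ 2 \<le> \<phi> n})) \<longlonglongrightarrow> 0"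
proof -
  define R where "R = 1 / (1 - \<beta>)"
  have R: "0 \<le> R" using beta_less by (simp add: R_def)
  let ?err = "\<lambda>n k. \<bar>measure (M n) {\<omega> \<in> space (M n). row_sum X n \<omega> = k} /
    (measure (M n) {\<omega> \<in> space (M n). row_sum X n \<omega> = 0} * (row_odds b n ^ k / fact k)) - 1\<bar>"
  let ?sup = "\<lambda>n. Sup0 (?err n ` {k. real k ^ 2 \<le> \<phi> n})"
  have bounds: "0 \<le> ?sup n" "?sup n \<le> R * \<bar>\<phi> n / row_mean b n\<bar>"
    if n: "n \<ge> 1" and mean: "0 < row_mean b n" for n
  proof -
    interpret prob_space "M n" by (rule prob[OF n])
    let ?r = "\<lambda>i. b i n / (1 - b i n)"
    let ?A = "{1..n}"
    have b0: "0 \<le> b i n" if "i \<in> ?A" for i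
      unfolding success[OF n that, symmetric] by (rule measure_nonneg)
    have b_less: "b i n < \<beta>" if "i \<in> ?A" for i
      using Max_ge[of "(\<lambda>i. b i n) ` ?A" "b i n"] max_less[OF n] that by (auto simp: row_max_def)
    have b1: "b i n < 1" if "i \<in> ?A" for i using b_less[OF that] beta_less by simp
    have r0: "0 \<le> ?r i" if "i \<in> ?A" for i using b0[OF that] b1[OF that] by simp
    have r_le: "?r i \<le> R" if "i \<in> ?A" for i
      unfolding R_def using b0[OF that] b1[OF that] b_less[OF that] beta_less
      by (intro frac_le) auto
    have odds_ge: "row_mean b n \<le> row_odds b n"
      unfolding row_mean_def row_odds_def
    proof (rule sum_mono)
      fix i assume "i \<in> ?A"
      from b0[OF this] b1[OF this] show "b i n \<le> ?r i"
        by (simp add: le_divide_eq mult_left_le)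
    qed
    have odds: "0 < sum ?r ?A" using odds_ge mean by (simp add: row_odds_def)
    have P: "prob {\<omega> \<in> space (M n). row_sum X n \<omega> = k} = (\<Prod>i\<in>?A. 1 - b i n) * esym ?r ?A k" for k
      unfolding row_sum_def
      by (rule prob_sum_Bernoulli) (use n indep[OF n] range01[OF n] success[OF n] b1 in auto)
    define c where "c = (\<Prod>i\<in>?A. 1 - b i n)"
    have "c > 0" unfolding c_def by (rule prod_pos) (use b1 in auto)
    then have err: "?err n k = \<bar>esym ?r ?A k / (sum ?r ?A ^ k / fact k) - 1\<bar>" for k
      by (simp add: P c_def[symmetric] esym_0 row_odds_def del: One_nat_def)
    have err_le: "?err n k \<le> R * \<bar>\<phi> n / row_mean b n\<bar>" if "k \<in> {k. real k ^ 2 \<le> \<phi> n}" for k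
    proof -
      have "?err n k \<le> R * real k ^ 2 / sum ?r ?A"
        unfolding err by (rule esym_ratio_bound) (use r0 r_le R odds in auto)
      also have "\<dots> \<le> R * \<bar>\<phi> n\<bar> / row_mean b n"
        using that odds_ge mean R
        by (intro frac_le mult_left_mono mult_nonneg_nonneg) (auto simp: row_odds_def)
      finally show ?thesis using mean by (simp add: abs_divide)
    qed
    show "0 \<le> ?sup n" "?sup n \<le> R * \<bar>\<phi> n / row_mean b n\<bar>"
      by (rule Sup0_image_bounds[where c = "R * \<bar>\<phi> n / row_mean b n\<bar>"];
        use err_le R in \<open>simp del: abs_divide\<close>)+
  qed
  have ev: "eventually (\<lambda>n. n \<ge> 1 \<and> 0 < row_mean b n) sequentially"
    using eventually_ge_at_top[of 1] filterlim_at_top_dense[THEN iffD1, OF mean_infinite]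
    by (auto intro: eventually_conj)
  have "(\<lambda>n. R * \<bar>\<phi> n / row_mean b n\<bar>) \<longlonglongrightarrow> R * \<bar>0\<bar>"
    by (intro tendsto_intros phi)
  then have lim: "(\<lambda>n. R * \<bar>\<phi> n / row_mean b n\<bar>) \<longlonglongrightarrow> 0" by simp
  show ?thesis
    by (rule tendsto_sandwich[OF _ _ tendsto_const lim])
      (use ev bounds in \<open>auto elim!: eventually_mono\<close>)
qed

end
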